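(* Let $n\ge 1$ and $0\le d\le n/2$ be integers and let $B=b_1,\dots,b_d\in\mathcal{B}_{n,d}$. With respect to any exchangeable measure, the squared norm of $\chi_B$ is $\|\chi_B\|^2=c_B\|\chi_d\|^2$, where $$c_B=\prod_{i=1}^d\frac{(b_i-2(i-1))(b_i-2(i-1)-1)}{2}$$ and $\chi_d=\prod_{i=1}^d(x_{2i-1}-x_{2i})$.
   Context: A polynomial $P\in\mathbb{R}[x_1,\dots,x_n]$ is multilinear if all its monomials are squarefree. A multilinear polynomial $P$ is harmonic if $\sum_{i=1}^n \partial P/\partial x_i=0$. $\mathcal{H}_n$ is the real vector space of harmonic multilinear polynomials in $x_1,\dots,x_n$. Write $[n]=\{1,\dots,n\}$. For an integer $0\le d\le n/2$, $\mathcal{S}_{n,d}$ is the set of sequences $S=s_1,\dots,s_d$ of distinct elements of $[n]$. For disjoint $A,B\in\mathcal{S}_{n,d}$ (no common elements), let $\chi_{A,B}=\prod_{i=1}^d (x_{a_i}-x_{b_i})$, and write $A<B$ if $a_i<b_i$ for all $i\in[d]$ ($A$ need not be increasing). A top set of length $d$ is an increasing sequence $B\in\mathcal{S}_{n,d}$ for which there exists a sequence $A\in\mathcal{S}_{n,d}$ disjoint from $B$ with $A<B$. $\mathcal{B}_{n,d}$ is the set of top sets of length $d$. For $B\in\mathcal{B}_{n,d}$, define $$\chi_B=\sum_{A\in\mathcal{S}_{n,d}:\ A\cap B=\emptyset,\ A<B}\chi_{A,B}$$ (so $\chi_\emptyset=1$, and $\chi_d=\chi_{2,4,\dots,2d}$).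 An exchangeable measure is a probability distribution $\mu$ of $(x_1,\dots,x_n)\in\mathbb{R}^n$ that is invariant under permutations of the indices; it is assumed that $\mathbb{E}_\mu|fg|<\infty$ for all $f,g\in\mathcal{H}_n$, and one puts $\langle f,g\rangle=\mathbb{E}_\mu[fg]$, $\|f\|=\sqrt{\langle f,f\rangle}$. *)

theory Defs
  imports "HOL-Probability.Probability" "HOL-Combinatorics.Permutations"
begin

text \<open>
  Real polynomials in \<open>x\<^sub>1, \<dots>, x\<^sub>n\<close> are identified with the polynomial functions they induce
  (a bijection, as the reals are infinite).  A point is a function \<open>x :: nat \<Rightarrow> real\<close> of which only
  the coordinates in \<open>{1..n}\<close> matter.
\<close>

definition multilinear_poly :: "nat \<Rightarrow> ((nat \<Rightarrow> real) \<Rightarrow> real) \<Rightarrow> bool" where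
  "multilinear_poly n f \<longleftrightarrow>
     (\<exists>c :: nat set \<Rightarrow> real. \<forall>x. f x = (\<Sum>S\<in>Pow {1..n}. c S * (\<Prod>i\<in>S. x i)))"

definition partial_deriv :: "nat \<Rightarrow> ((nat \<Rightarrow> real) \<Rightarrow> real) \<Rightarrow> (nat \<Rightarrow> real) \<Rightarrow> real" where
  "partial_deriv i f x = deriv (\<lambda>t. f (x(i := t))) (x i)"

definition harmonic_multilinear :: "nat \<Rightarrow> ((nat \<Rightarrow> real) \<Rightarrow> real) set" where
  "harmonic_multilinear n =
     {f. multilinear_poly n f \<and> (\<forall>x. (\<Sum>i = 1..n. partial_deriv i f x) = 0)}"

text \<open>
  Sequences are lists, so the entry \<open>b\<^sub>i\<close> of a sequence (indexed from 1) is \<open>B ! (i - 1)\<close>.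
\<close>

definition seqs :: "nat \<Rightarrow> nat \<Rightarrow> nat list set" where
  "seqs n d = {S. length S = d \<and> distinct S \<and> set S \<subseteq> {1..n}}"

definition seq_less :: "nat list \<Rightarrow> nat list \<Rightarrow> bool" where
  "seq_less A B \<longleftrightarrow> list_all2 (<) A B"

definition top_sets :: "nat \<Rightarrow> nat \<Rightarrow> nat list set" where
  "top_sets n d =
     {B \<in> seqs n d. sorted_wrt (<) B \<and> (\<exists>A\<in>seqs n d. set A \<inter> set B = {} \<and> seq_less A B)}"

definition chi_pair :: "nat list \<Rightarrow> nat list \<Rightarrow> (nat \<Rightarrow> real) \<Rightarrow> real" where
  "chi_pair A B x = (\<Prod>i = 1..length B. x (A ! (i - 1)) - x (B ! (i - 1)))"

definition chi_top :: "nat \<Rightarrow> nat list \<Rightarrow> (nat \<Rightarrow> real) \<Rightarrow> real" where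
  "chi_top n B x =
     (\<Sum>A\<in>{A \<in> seqs n (length B). set A \<inter> set B = {} \<and> seq_less A B}. chi_pair A B x)"

definition chi_deg :: "nat \<Rightarrow> (nat \<Rightarrow> real) \<Rightarrow> real" where
  "chi_deg d x = (\<Prod>i = 1..d. x (2 * i - 1) - x (2 * i))"

definition c_coeff :: "nat list \<Rightarrow> real" where
  "c_coeff B =
     (\<Prod>i = 1..length B.
        (real (B ! (i - 1)) - 2 * (real i - 1)) * (real (B ! (i - 1)) - 2 * (real i - 1) - 1) / 2)"

text \<open>
  The space \<open>\<real>\<^sup>n\<close> is the product of \<open>n\<close> copies of the Borel space on the reals, indexed by \<open>{1..n}\<close>;
  its points are the functions that are \<open>undefined\<close> outside \<open>{1..n}\<close>.
\<close>

definition exchangeable :: "nat \<Rightarrow> (nat \<Rightarrow> real) measure \<Rightarrow> bool" where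
  "exchangeable n \<mu> \<longleftrightarrow>
     prob_space \<mu> \<and>
     sets \<mu> = sets (\<Pi>\<^sub>M i\<in>{1..n}. (borel :: real measure)) \<and>
     (\<forall>\<pi>. \<pi> permutes {1..n} \<longrightarrow> distr \<mu> \<mu> (\<lambda>x. \<lambda>i\<in>{1..n}. x (\<pi> i)) = \<mu>)"

definition inner_mu :: "(nat \<Rightarrow> real) measure \<Rightarrow> ((nat \<Rightarrow> real) \<Rightarrow> real) \<Rightarrow> ((nat \<Rightarrow> real) \<Rightarrow> real) \<Rightarrow> real" where
  "inner_mu \<mu> f g = (LINT x|\<mu>. f x * g x)"

definition norm_mu :: "(nat \<Rightarrow> real) measure \<Rightarrow> ((nat \<Rightarrow> real) \<Rightarrow> real) \<Rightarrow> real" where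
  "norm_mu \<mu> f = sqrt (inner_mu \<mu> f f)"

end

theory Submission imports Defs begin

text \<open>
  \<open>\<chi>\<^bsub>A,B\<^esub>\<close> changes sign under each transposition \<open>(a\<^sub>i b\<^sub>i)\<close>, and antisymmetrising a multilinear polynomial
  of degree \<open>d\<close> under these \<open>d\<close> transpositions gives a multiple of \<open>\<chi>\<^bsub>A,B\<^esub>\<close>.  Hence
  \<open>\<langle>\<chi>\<^bsub>A,B\<^esub>, g\<rangle> = w \<parallel>\<chi>\<^sub>d\<parallel>\<^sup>2\<close> with a constant \<open>w\<close> that is the same for all permutation invariant forms,
  and it suffices to compute \<open>\<parallel>\<chi>\<^sub>B\<parallel>\<^sup>2 / \<parallel>\<chi>\<^sub>d\<parallel>\<^sup>2\<close> for the uniform measure on \<open>{-1,1}\<^sup>n\<close>.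

  Let \<open>m\<close> be the largest element of \<open>B\<close>, \<open>B'\<close> the rest, \<open>k = m - 1 - 2(d - 1)\<close> and
  \<open>S = x\<^sub>1 + \<dots> + x\<^bsub>m-1\<^esub>\<close>.  On the cube \<open>(x\<^sub>a - x\<^sub>b)(x\<^sub>a + x\<^sub>b) = 0\<close>, so \<open>\<chi>\<^sub>B = \<chi>\<^bsub>B'\<^esub> (S - k x\<^sub>m)\<close> there.
  As \<open>x\<^sub>m\<close> is independent of the rest, \<open>\<parallel>\<chi>\<^sub>B\<parallel>\<^sup>2 = E[\<chi>\<^bsub>B'\<^esub>\<^sup>2 S\<^sup>2] + k\<^sup>2 \<parallel>\<chi>\<^bsub>B'\<^esub>\<parallel>\<^sup>2\<close>.  The weight \<open>S\<^sup>2\<close> is itself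
  permutation invariant in \<open>x\<^sub>1, \<dots>, x\<^bsub>m-1\<^esub>\<close>, so the first term may be computed with \<open>\<chi>\<^bsub>d-1\<^esub>\<close> in place of
  \<open>\<chi>\<^bsub>B'\<^esub>\<close>, where it equals \<open>k \<parallel>\<chi>\<^bsub>d-1\<^esub>\<parallel>\<^sup>2\<close>; thus \<open>\<parallel>\<chi>\<^sub>B\<parallel>\<^sup>2 = k(k + 1) \<parallel>\<chi>\<^bsub>B'\<^esub>\<parallel>\<^sup>2\<close>,
  while \<open>\<parallel>\<chi>\<^sub>d\<parallel>\<^sup>2 = 2 \<parallel>\<chi>\<^bsub>d-1\<^esub>\<parallel>\<^sup>2\<close>.
\<close>

section \<open>Recursion and symmetry of the products \<open>chi_pair\<close>\<close>

lemma chi_pair_Nil [simp]: "chi_pair A [] x = 1"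
  by (simp add: chi_pair_def)

lemma chi_pair_lessThan: "chi_pair A B x = (\<Prod>i<length B. x (A ! i) - x (B ! i))"
  unfolding chi_pair_def
  by (rule prod.reindex_bij_witness[of _ Suc "\<lambda>i. i - 1"]) auto

lemma chi_pair_Cons: "chi_pair (a # A) (b # B) x = (x a - x b) * chi_pair A B x"
  unfolding chi_pair_lessThan by (simp only: length_Cons prod.lessThan_Suc_shift) simp

lemma chi_pair_snoc:
  assumes "length A = length B"
  shows "chi_pair (A @ [a]) (B @ [b]) x = chi_pair A B x * (x a - x b)"
  unfolding chi_pair_lessThan using assms by (simp add: nth_append)

lemma chi_pair_comp:
  assumes "length A = length B"
  shows "chi_pair A B (x \<circ> \<pi>) = chi_pair (map \<pi> A) (map \<pi> B) x"
  unfolding chi_pair_lessThan using assms by simp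

lemma chi_pair_cong:
  assumes "length A = length B" "\<And>i. i \<in> set A \<union> set B \<Longrightarrow> x i = y i"
  shows "chi_pair A B x = chi_pair A B y"
  unfolding chi_pair_lessThan using assms by (intro prod.cong) auto

text \<open>The transposition negates factor \<open>i\<close> and, all entries of \<open>A\<close>
  and \<open>B\<close> being distinct, moves no entry of the other factors.\<close>

lemma chi_pair_transpose:
  assumes "length A = length B" "distinct A" "distinct B" "set A \<inter> set B = {}" "i < length B"
  shows "chi_pair A B (x \<circ> Transposition.transpose (A ! i) (B ! i)) = - chi_pair A B x"
proof -
  let ?t = "Transposition.transpose (A ! i) (B ! i)"
  have fixed: "?t (A ! j) = A ! j \<and> ?t (B ! j) = B ! j" if "j \<in> {..<length B} - {i}" for j
  proof -
    have "A ! j \<noteq> A ! i" "B ! j \<noteq> B ! i"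
      using that assms by (auto simp: nth_eq_iff_index_eq)
    moreover have "A ! j \<noteq> B ! i" "B ! j \<noteq> A ! i"
      using that assms by (metis DiffD1 disjoint_iff lessThan_iff nth_mem)+
    ultimately show ?thesis by (simp add: Transposition.transpose_def)
  qed
  have "chi_pair A B (x \<circ> ?t)
      = (x (?t (A ! i)) - x (?t (B ! i)))
        * (\<Prod>j\<in>{..<length B} - {i}. x (?t (A ! j)) - x (?t (B ! j)))"
    unfolding chi_pair_lessThan using assms by (subst prod.remove[of _ i]) auto
  also have "\<dots> = (x (B ! i) - x (A ! i)) * (\<Prod>j\<in>{..<length B} - {i}. x (A ! j) - x (B ! j))"
    using fixed by simp
  also have "\<dots> = - chi_pair A B x"
    unfolding chi_pair_lessThan using assms
    by (subst prod.remove[of "{..<length B}" i]) (auto simp: algebra_simps)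
  finally show ?thesis .
qed

section \<open>Spans of monomials and of the products \<open>\<chi>\<^bsub>A,B\<^esub>\<close>\<close>

text \<open>A squarefree monomial is encoded by its finite set of variables. Recording the variables
  in \<open>U\<close> besides the degree bound \<open>k\<close> makes it possible to multiply by a
  further variable and stay squarefree.\<close>

inductive_set monom_span :: "nat set \<Rightarrow> nat \<Rightarrow> ((nat \<Rightarrow> real) \<Rightarrow> real) set" for U k where
  monom: "S \<subseteq> U \<Longrightarrow> finite S \<Longrightarrow> card S \<le> k \<Longrightarrow> (\<lambda>x. \<Prod>i\<in>S. x i) \<in> monom_span U k"
| add: "f \<in> monom_span U k \<Longrightarrow> g \<in> monom_span U k \<Longrightarrow> (\<lambda>x. f x + g x) \<in> monom_span U k"
| scale: "f \<in> monom_span U k \<Longrightarrow> (\<lambda>x. c * f x) \<in> monom_span U k"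

lemma monom_span_mult_var:
  assumes "f \<in> monom_span U k" "a \<notin> U" "insert a U \<subseteq> U'"
  shows "(\<lambda>x. x a * f x) \<in> monom_span U' (Suc k)"
  using assms(1)
proof induction
  case (monom S)
  have "(\<lambda>x. \<Prod>i\<in>insert a S. x i :: real) \<in> monom_span U' (Suc k)"
    by (rule monom_span.monom) (use monom assms in \<open>auto simp: card_insert_if\<close>)
  moreover have "a \<notin> S" using monom assms by auto
  ultimately show ?case using monom by simp
next
  case (add f g)
  then show ?case using monom_span.add by (simp add: distrib_left)
next
  case (scale f c)
  then show ?case using monom_span.scale[of "\<lambda>x. x a * f x" U' "Suc k" c]
    by (simp add: mult.left_commute)
qed

lemma chi_pair_monom_span:
  assumes "length A = length B" "distinct A" "distinct B" "set A \<inter> set B = {}"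
  shows "chi_pair A B \<in> monom_span (set A \<union> set B) (length B)"
  using assms
proof (induction A B rule: list_induct2)
  case Nil
  have "(\<lambda>x. \<Prod>i\<in>{}. x i :: real) \<in> monom_span {} 0"
    by (rule monom_span.monom) auto
  moreover have "chi_pair [] [] = (\<lambda>x. 1)" by auto
  ultimately show ?case by simp
next
  case (Cons a A b B)
  let ?U = "set (a # A) \<union> set (b # B)" and ?k = "length (b # B)"
  have IH: "chi_pair A B \<in> monom_span (set A \<union> set B) (length B)"
    using Cons by auto
  have "(\<lambda>x. x a * chi_pair A B x) \<in> monom_span ?U (Suc (length B))"
    by (rule monom_span_mult_var[OF IH]) (use Cons in auto)
  moreover have "(\<lambda>x. x b * chi_pair A B x) \<in> monom_span ?U (Suc (length B))"
    by (rule monom_span_mult_var[OF IH]) (use Cons in auto)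
  ultimately have "(\<lambda>x. x a * chi_pair A B x + (-1) * (x b * chi_pair A B x)) \<in> monom_span ?U ?k"
    unfolding length_Cons by (intro monom_span.add monom_span.scale)
  moreover have "chi_pair (a # A) (b # B) = (\<lambda>x. x a * chi_pair A B x + (-1) * (x b * chi_pair A B x))"
    by (auto simp: chi_pair_Cons algebra_simps)
  ultimately show ?case by simp
qed

lemma monom_span_multilinear:
  assumes "f \<in> monom_span U k" "U \<subseteq> {1..n}"
  shows "multilinear_poly n f"
  using assms(1)
proof induction
  case (monom S)
  have "(\<Prod>i\<in>S. x i) = (\<Sum>T\<in>Pow {1..n}. (if T = S then 1 else 0) * (\<Prod>i\<in>T. x i))" for x :: "nat \<Rightarrow> real"
    using monom assms by (subst sum.remove[of _ S]) auto
  then show ?case unfolding multilinear_poly_def by (intro exI allI)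
next
  case (add f g)
  then obtain c c' where "\<forall>x. f x = (\<Sum>S\<in>Pow {1..n}. c S * (\<Prod>i\<in>S. x i))"
    "\<forall>x. g x = (\<Sum>S\<in>Pow {1..n}. c' S * (\<Prod>i\<in>S. x i))"
    unfolding multilinear_poly_def by blast
  then have "\<forall>x. f x + g x = (\<Sum>S\<in>Pow {1..n}. (c S + c' S) * (\<Prod>i\<in>S. x i))"
    by (simp add: distrib_right sum.distrib)
  then show ?case unfolding multilinear_poly_def by (rule exI[of _ "\<lambda>S. c S + c' S"])
next
  case (scale f r)
  then obtain c where "\<forall>x. f x = (\<Sum>S\<in>Pow {1..n}. c S * (\<Prod>i\<in>S. x i))"
    unfolding multilinear_poly_def by blast
  then have "\<forall>x. r * f x = (\<Sum>S\<in>Pow {1..n}. (r * c S) * (\<Prod>i\<in>S. x i))"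
    by (simp add: sum_distrib_left mult.assoc)
  then show ?case unfolding multilinear_poly_def by (rule exI[of _ "\<lambda>S. r * c S"])
qed

text \<open>The sum of all partial derivatives is a derivation that kills each factor
  \<open>x a - x b\<close>. The witness \<open>D\<close> carries along the differentiability that
  the product rule requires.\<close>

lemma chi_pair_partial_derivs:
  assumes "length A = length B" "set A \<subseteq> {1..n}" "set B \<subseteq> {1..n}"
  shows "\<exists>D. (\<forall>i x. ((\<lambda>t. chi_pair A B (x(i := t))) has_field_derivative D i x) (at (x i)))
    \<and> (\<forall>x. (\<Sum>i = 1..n. D i x) = (0::real))"
  using assms
proof (induction A B rule: list_induct2)
  case Nil
  show ?case by (rule exI[of _ "\<lambda>i x. 0"]) auto
next
  case (Cons a A b B)
  from Cons.prems have "set A \<subseteq> {1..n}" "set B \<subseteq> {1..n}" by auto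
  from Cons.IH[OF this] obtain D where
    D: "\<And>i x. ((\<lambda>t. chi_pair A B (x(i := t))) has_field_derivative D i x) (at (x i))"
    and D0: "\<And>x. (\<Sum>i = 1..n. D i x) = 0"
    by blast
  define \<delta> :: "nat \<Rightarrow> nat \<Rightarrow> real" where "\<delta> i j = (if i = j then 1 else 0)" for i j
  have coord: "((\<lambda>t. (x(i := t)) j) has_field_derivative \<delta> i j) (at (x i))" for x :: "nat \<Rightarrow> real" and i j
    by (auto simp: \<delta>_def)
  define D' where "D' i x = (\<delta> i a - \<delta> i b) * chi_pair A B x + (x a - x b) * D i x" for i x
  have "((\<lambda>t. chi_pair (a # A) (b # B) (x(i := t))) has_field_derivative D' i x) (at (x i))" for i x
    unfolding chi_pair_Cons D'_def
    using DERIV_mult[OF DERIV_diff[OF coord[of x i a] coord[of x i b]] D[of x i]]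
    by (simp add: algebra_simps)
  moreover have "(\<Sum>i = 1..n. D' i x) = 0" for x
  proof -
    have one: "(\<Sum>i = 1..n. \<delta> i j) = 1" if "j \<in> {1..n}" for j
      using that by (simp add: \<delta>_def)
    have "(\<Sum>i = 1..n. D' i x)
        = ((\<Sum>i = 1..n. \<delta> i a) - (\<Sum>i = 1..n. \<delta> i b)) * chi_pair A B x + (x a - x b) * (\<Sum>i = 1..n. D i x)"
      by (simp add: D'_def sum.distrib sum_subtractf sum_distrib_left flip: sum_distrib_right)
    then show ?thesis using Cons.prems D0[of x] one[of a] one[of b] by simp
  qed
  ultimately show ?case by blast
qed

text \<open>The integrability hypothesis of the theorem speaks of harmonic polynomials; this makes
  it available for \<open>chi_pair\<close>.\<close>

lemma chi_pair_harmonic: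
  assumes "A \<in> seqs n d" "B \<in> seqs n d" "set A \<inter> set B = {}"
  shows "chi_pair A B \<in> harmonic_multilinear n"
proof -
  have AB: "length A = length B" "distinct A" "distinct B" "set A \<subseteq> {1..n}" "set B \<subseteq> {1..n}"
    using assms by (auto simp: seqs_def)
  have "multilinear_poly n (chi_pair A B)"
    using chi_pair_monom_span[OF AB(1-3) assms(3)] monom_span_multilinear AB(4,5) by blast
  moreover obtain D where
    D: "\<And>i x. ((\<lambda>t. chi_pair A B (x(i := t))) has_field_derivative D i x) (at (x i))"
    and D0: "\<And>x. (\<Sum>i = 1..n. D i x) = 0"
    using chi_pair_partial_derivs[OF AB(1,4,5)] by blast
  have "partial_deriv i (chi_pair A B) x = D i x" for i x
    unfolding partial_deriv_def by (rule DERIV_imp_deriv[OF D])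
  then have "\<forall>x. (\<Sum>i = 1..n. partial_deriv i (chi_pair A B) x) = 0"
    using D0 by simp
  ultimately show ?thesis by (simp add: harmonic_multilinear_def)
qed

text \<open>There is no rule for the zero function: the set is empty if no disjoint
  \<open>A\<close>, \<open>B\<close> exist, so sums are taken over nonempty index sets.\<close>

inductive_set chi_span :: "nat \<Rightarrow> nat \<Rightarrow> ((nat \<Rightarrow> real) \<Rightarrow> real) set" for n d where
  chi: "A \<in> seqs n d \<Longrightarrow> B \<in> seqs n d \<Longrightarrow> set A \<inter> set B = {} \<Longrightarrow> chi_pair A B \<in> chi_span n d"
| add: "f \<in> chi_span n d \<Longrightarrow> g \<in> chi_span n d \<Longrightarrow> (\<lambda>x. f x + g x) \<in> chi_span n d"
| scale: "f \<in> chi_span n d \<Longrightarrow> (\<lambda>x. c * f x) \<in> chi_span n d"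

lemma chi_span_diff:
  assumes "f \<in> chi_span n d" "g \<in> chi_span n d"
  shows "(\<lambda>x. f x - g x) \<in> chi_span n d"
  using chi_span.add[OF assms(1) chi_span.scale[OF assms(2), of "-1"]] by simp

lemma chi_span_sum:
  assumes "finite I" "I \<noteq> {}" "\<And>i. i \<in> I \<Longrightarrow> f i \<in> chi_span n d"
  shows "(\<lambda>x. \<Sum>i\<in>I. f i x) \<in> chi_span n d"
  using assms by (induction I rule: finite_ne_induct) (auto intro: chi_span.add)

lemma chi_span_cong:
  assumes "f \<in> chi_span n d" "\<And>i. i \<in> {1..n} \<Longrightarrow> x i = y i"
  shows "f x = f y"
  using assms(1)
proof induction
  case (chi A B)
  show ?case by (rule chi_pair_cong) (use chi assms(2) in \<open>auto simp: seqs_def\<close>)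
qed auto

lemma map_permutes_seqs:
  assumes "\<pi> permutes {1..n}" "A \<in> seqs n d"
  shows "map \<pi> A \<in> seqs n d"
proof -
  have "\<pi> ` set A \<subseteq> \<pi> ` {1..n}" using assms by (intro image_mono) (simp add: seqs_def)
  then show ?thesis
    using assms permutes_image[OF assms(1)] permutes_inj_on[OF assms(1), of "set A"]
    by (simp add: seqs_def distinct_map)
qed

lemma chi_span_comp:
  assumes "f \<in> chi_span n d" "\<pi> permutes {1..n}"
  shows "(\<lambda>x. f (x \<circ> \<pi>)) \<in> chi_span n d"
  using assms(1)
proof induction
  case (chi A B)
  have "set (map \<pi> A) \<inter> set (map \<pi> B) = {}"
    using chi by (simp flip: image_Int[OF permutes_inj[OF assms(2)]])
  then have "chi_pair (map \<pi> A) (map \<pi> B) \<in> chi_span n d"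
    using chi map_permutes_seqs[OF assms(2)] by (intro chi_span.chi) auto
  moreover have "(\<lambda>x. chi_pair A B (x \<circ> \<pi>)) = chi_pair (map \<pi> A) (map \<pi> B)"
    using chi by (auto simp: chi_pair_comp seqs_def)
  ultimately show ?case by (simp only:)
qed (auto intro: chi_span.intros)

lemma chi_span_monom_span: "f \<in> chi_span n d \<Longrightarrow> f \<in> monom_span {1..n} d"
proof (induction rule: chi_span.induct)
  case (chi A B)
  have mono: "g \<in> monom_span U k \<Longrightarrow> U \<subseteq> U' \<Longrightarrow> g \<in> monom_span U' k" for g U U' k
    by (induction rule: monom_span.induct) (auto intro: monom_span.intros)
  show ?case
    using chi mono[OF chi_pair_monom_span[of A B], of "{1..n}"] by (auto simp: seqs_def)
qed (auto intro: monom_span.intros)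

section \<open>Antisymmetrisation\<close>

text \<open>The product of the operators \<open>1 - t\<close>, one for each pair, where
  \<open>t\<close> composes with the transposition of that pair. It is not divided by
  \<open>2 ^ length A\<close>, hence the powers of 2 below.\<close>

fun alternate :: "nat list \<Rightarrow> nat list \<Rightarrow> ((nat \<Rightarrow> real) \<Rightarrow> real) \<Rightarrow> (nat \<Rightarrow> real) \<Rightarrow> real" where
  "alternate (a # A) (b # B) f =
     alternate A B (\<lambda>x. f x - f (x \<circ> Transposition.transpose a b))"
| "alternate _ _ f = f"

lemma alternate_add:
  "alternate A B (\<lambda>x. f x + g x) x = alternate A B f x + alternate A B g x"
proof (induction A B f arbitrary: g rule: alternate.induct)
  case (1 a A b B f)
  show ?case
    using 1[of "\<lambda>x. g x - g (x \<circ> Transposition.transpose a b)"] by (simp add: algebra_simps)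
qed auto

text \<open>An invariant factor behaves as a scalar for every \<open>1 - t\<close>. With a constant
  factor this is homogeneity.\<close>

lemma alternate_mult_invariant:
  assumes "length A = length B"
    "\<And>a b x. (a, b) \<in> set (zip A B) \<Longrightarrow> g (x \<circ> Transposition.transpose a b) = g x"
  shows "alternate A B (\<lambda>x. g x * f x) x = g x * alternate A B f x"
  using assms
proof (induction A B arbitrary: f rule: list_induct2)
  case (Cons a A b B)
  have "(\<lambda>x. g x * f x - g (x \<circ> Transposition.transpose a b) * f (x \<circ> Transposition.transpose a b))
      = (\<lambda>x. g x * (f x - f (x \<circ> Transposition.transpose a b)))"
    by (simp only: Cons.prems[of a b] list.set zip_Cons_Cons insertI1 right_diff_distrib)
  moreover have "alternate A B (\<lambda>x. g x * h x) x = g x * alternate A B h x" for h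
    by (rule Cons.IH) (use Cons.prems in auto)
  ultimately show ?case by (simp only: alternate.simps)
qed simp

text \<open>For a pair \<open>a\<close>, \<open>b\<close> the difference vanishes unless
  \<open>S\<close> contains exactly one of them. Then \<open>x a - x b\<close> splits off up to sign
  and the remaining monomial has degree one less; with no pair left, the degree bound leaves only
  the empty monomial.\<close>

lemma alternate_monom:
  assumes "length A = length B" "distinct (A @ B)" "finite S" "card S \<le> length A"
  shows "\<exists>w. \<forall>x. alternate A B (\<lambda>x. \<Prod>i\<in>S. x i) x = w * chi_pair A B x"
  using assms
proof (induction A B arbitrary: S rule: list_induct2)
  case Nil
  then show ?case by auto
next
  case (Cons a A b B)
  let ?t = "Transposition.transpose a b"
  let ?m = "\<lambda>S x. \<Prod>i\<in>S. x i :: real"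
  have ab: "a \<noteq> b" using Cons.prems by auto
  have image: "?m S (x \<circ> ?t) = ?m (?t ` S) x" for x S
    by (subst prod.reindex) (auto intro: inj_on_subset)
  \<comment> \<open>\<open>c\<close> is the one of \<open>a\<close>, \<open>b\<close> that lies in
    \<open>S\<close>; both cases are treated at once, up to sign.\<close>
  have step: "\<exists>w. \<forall>x. alternate A B (\<lambda>x. ?m S x - ?m S (x \<circ> ?t)) x = w * chi_pair (a # A) (b # B) x"
    if c: "c \<in> S" "c' \<notin> S" "{c, c'} = {a, b}" for c c'
  proof -
    let ?R = "S - {c}"
    have t: "?t c = c'" using c(3) ab by (auto simp: doubleton_eq_iff)
    have "?t ` ?R = ?R"
    proof -
      have "?t i = i" if "i \<in> ?R" for i
        using that c by (auto simp: Transposition.transpose_def doubleton_eq_iff)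
      then show ?thesis by auto
    qed
    then have "?t ` S = insert c' ?R"
      using c(1) t by (metis image_insert insert_Diff)
    then have eq: "(\<lambda>x. ?m S x - ?m S (x \<circ> ?t)) = (\<lambda>x. (x c - x c') * ?m ?R x)"
      unfolding image using Cons.prems(2) c by (auto simp: prod.remove[of S c] left_diff_distrib)
    have cc: "c \<notin> set A \<union> set B" "c' \<notin> set A \<union> set B"
      using Cons.prems(1) c(3) by (auto simp: doubleton_eq_iff)
    have "card ?R \<le> length A" using Cons.prems c by simp
    then obtain w where w: "\<And>x. alternate A B (?m ?R) x = w * chi_pair A B x"
      using Cons.IH[of ?R] Cons.prems by auto
    \<comment> \<open>The remaining transpositions fix \<open>c\<close> and \<open>c'\<close>, so
      the factor can be pulled out.\<close>
    have "(x \<circ> Transposition.transpose p q) c - (x \<circ> Transposition.transpose p q) c' = x c - x c'"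
      if "(p, q) \<in> set (zip A B)" for p q and x :: "nat \<Rightarrow> real"
      using that cc by (auto simp: Transposition.transpose_def dest: set_zip_leftD set_zip_rightD)
    then have "alternate A B (\<lambda>x. (x c - x c') * ?m ?R x) x = (x c - x c') * (w * chi_pair A B x)" for x
      using alternate_mult_invariant[OF Cons.hyps, of "\<lambda>x. x c - x c'" "?m ?R" x] w by simp
    then have "alternate A B (\<lambda>x. ?m S x - ?m S (x \<circ> ?t)) x
        = (if c = a then w else - w) * chi_pair (a # A) (b # B) x" for x
      unfolding eq using c(3) ab by (auto simp: chi_pair_Cons doubleton_eq_iff algebra_simps)
    then show ?thesis by blast
  qed
  consider "a \<in> S \<longleftrightarrow> b \<in> S" | "a \<in> S" "b \<notin> S" | "b \<in> S" "a \<notin> S" by blast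
  then show ?case
  proof cases
    case 1
    then have "?t ` S = S" by simp
    \<comment> \<open>Zero is written \<open>0 * 0\<close> to fit
      \<open>alternate_mult_invariant\<close>.\<close>
    then have "(\<lambda>x. ?m S x - ?m S (x \<circ> ?t)) = (\<lambda>x. 0 * 0)" unfolding image by simp
    moreover have "alternate A B (\<lambda>x. 0 * 0) x = 0" for x
      using alternate_mult_invariant[OF Cons.hyps, of "\<lambda>_. 0" "\<lambda>_. 0" x] by simp
    ultimately show ?thesis by (intro exI[of _ 0]) simp
  next
    case 2
    then show ?thesis using step[of a b] by simp
  next
    case 3
    then show ?thesis using step[of b a] by (simp add: insert_commute)
  qed
qed

text \<open>Multilinearity and the degree bound are essential: a monomial survives antisymmetrisation
  only if it contains exactly one index of each of the \<open>d\<close> pairs, hence nothing else.\<close>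

lemma alternate_monom_span:
  assumes "length A = length B" "distinct (A @ B)" "f \<in> monom_span U (length A)"
  shows "\<exists>w. \<forall>x. alternate A B f x = w * chi_pair A B x"
  using assms(3)
proof induction
  case (monom S)
  then show ?case using alternate_monom assms by blast
next
  case (add f g)
  then obtain w w' where "\<forall>x. alternate A B f x = w * chi_pair A B x"
    "\<forall>x. alternate A B g x = w' * chi_pair A B x" by blast
  then show ?case by (intro exI[of _ "w + w'"]) (simp add: alternate_add distrib_right)
next
  case (scale f c)
  then obtain w where "\<forall>x. alternate A B f x = w * chi_pair A B x" by blast
  then show ?case
    using alternate_mult_invariant[OF assms(1), of "\<lambda>_. c" f]
    by (intro exI[of _ "c * w"]) simp
qed

section \<open>Permutation invariant forms\<close>

text \<open>The form is constrained only on products of two elements of \<open>chi_span\<close>,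
  since for a measure only these are known to be integrable. Symmetry comes from commutativity of
  multiplication.\<close>

locale invariant_form =
  fixes n d :: nat and L :: "((nat \<Rightarrow> real) \<Rightarrow> real) \<Rightarrow> real"
  assumes form_add: "f \<in> chi_span n d \<Longrightarrow> g \<in> chi_span n d \<Longrightarrow> h \<in> chi_span n d \<Longrightarrow>
      L (\<lambda>x. f x * (g x + h x)) = L (\<lambda>x. f x * g x) + L (\<lambda>x. f x * h x)"
    and form_scale: "f \<in> chi_span n d \<Longrightarrow> g \<in> chi_span n d \<Longrightarrow>
      L (\<lambda>x. f x * (c * g x)) = c * L (\<lambda>x. f x * g x)"
    and form_invariant: "f \<in> chi_span n d \<Longrightarrow> g \<in> chi_span n d \<Longrightarrow> \<pi> permutes {1..n} \<Longrightarrow>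
      L (\<lambda>x. f (x \<circ> \<pi>) * g (x \<circ> \<pi>)) = L (\<lambda>x. f x * g x)"
begin

lemma form_commute: "L (\<lambda>x. f x * g x) = L (\<lambda>x. g x * f x)"
  by (simp add: mult.commute)

text \<open>By invariance each \<open>1 - t\<close> is symmetric for the form, and on a function
  antisymmetric under \<open>t\<close> it acts as multiplication by 2; each pair thus contributes a
  factor 2.\<close>

lemma form_alternate:
  assumes "length A = length B" "set A \<subseteq> {1..n}" "set B \<subseteq> {1..n}"
    "f \<in> chi_span n d" "g \<in> chi_span n d"
    "\<And>a b x. (a, b) \<in> set (zip A B) \<Longrightarrow> f (x \<circ> Transposition.transpose a b) = - f x"
  shows "L (\<lambda>x. f x * alternate A B g x) = 2 ^ length A * L (\<lambda>x. f x * g x)"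
  using assms
proof (induction A B arbitrary: g rule: list_induct2)
  case (Cons a A b B)
  let ?t = "Transposition.transpose a b"
  let ?gt = "\<lambda>x. g (x \<circ> ?t)" and ?ft = "\<lambda>x. f (x \<circ> ?t)"
  have t: "?t permutes {1..n}" using Cons.prems by (intro permutes_swap_id) auto
  have gt: "?gt \<in> chi_span n d" and ft: "?ft \<in> chi_span n d"
    using chi_span_comp t Cons.prems by blast+
  have anti: "f = (\<lambda>x. (-1) * ?ft x)"
    using Cons.prems(5)[of a b] by (auto simp del: o_apply)
  have "L (\<lambda>x. f x * ?gt x) = L (\<lambda>x. ?gt x * f x)" by (rule form_commute)
  also have "\<dots> = L (\<lambda>x. ?gt x * ((-1) * ?ft x))" by (subst anti) (rule refl)
  also have "\<dots> = (-1) * L (\<lambda>x. ?gt x * ?ft x)" by (rule form_scale[OF gt ft])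
  also have "\<dots> = - L (\<lambda>x. f x * g x)"
    unfolding form_invariant[OF Cons.prems(4,3) t] form_commute[of g f] by simp
  finally have swap: "L (\<lambda>x. f x * ?gt x) = - L (\<lambda>x. f x * g x)" .
  have h: "(\<lambda>x. g x - ?gt x) \<in> chi_span n d"
    using Cons.prems(4) gt by (rule chi_span_diff)
  have "L (\<lambda>x. f x * (g x - ?gt x)) = L (\<lambda>x. f x * (g x + (-1) * ?gt x))" by simp
  also have "\<dots> = L (\<lambda>x. f x * g x) + L (\<lambda>x. f x * ((-1) * ?gt x))"
    by (rule form_add[OF Cons.prems(3,4) chi_span.scale[OF gt]])
  also have "\<dots> = 2 * L (\<lambda>x. f x * g x)"
    using form_scale[OF Cons.prems(3) gt, of "-1"] swap by simp
  finally have "L (\<lambda>x. f x * (g x - ?gt x)) = 2 * L (\<lambda>x. f x * g x)" .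
  moreover have "L (\<lambda>x. f x * alternate A B (\<lambda>x. g x - ?gt x) x)
      = 2 ^ length A * L (\<lambda>x. f x * (g x - ?gt x))"
  proof (rule Cons.IH[OF _ _ Cons.prems(3) h])
    show "f (x \<circ> Transposition.transpose a' b') = - f x" if "(a', b') \<in> set (zip A B)" for a' b' x
      by (rule Cons.prems(5)) (use that in simp)
  qed (use Cons.prems in auto)
  ultimately show ?case by simp
qed simp

end

text \<open>Both lists are completed to enumerations of \<open>U\<close>; the permutation matches
  entries at equal positions.\<close>

lemma permutes_extending_lists:
  assumes "finite U" "distinct xs" "distinct ys" "length xs = length ys"
    "set xs \<subseteq> U" "set ys \<subseteq> U"
  shows "\<exists>\<pi>. \<pi> permutes U \<and> map \<pi> xs = ys"
proof -
  obtain zs where zs: "set zs = U - set xs" "distinct zs"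
    using finite_distinct_list[of "U - set xs"] assms(1) by blast
  obtain ws where ws: "set ws = U - set ys" "distinct ws"
    using finite_distinct_list[of "U - set ys"] assms(1) by blast
  define X Y where "X = xs @ zs" and "Y = ys @ ws"
  have X: "distinct X" "set X = U" and Y: "distinct Y" "set Y = U"
    using zs ws assms by (auto simp: X_def Y_def)
  have len: "length X = length Y"
    using distinct_card[OF X(1)] distinct_card[OF Y(1)] X Y by simp
  define N where "N = length X"
  have bX: "bij_betw ((!) X) {..<N} U" and bY: "bij_betw ((!) Y) {..<N} U"
    using X Y len by (auto intro: bij_betw_nth simp: N_def)
  define \<pi> where "\<pi> i = (if i \<in> U then Y ! (inv_into {..<N} ((!) X) i) else i)" for i
  have "bij_betw (\<lambda>i. Y ! (inv_into {..<N} ((!) X) i)) U U"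
    using bij_betw_trans[OF bij_betw_inv_into[OF bX] bY] by (simp add: comp_def)
  then have "bij_betw \<pi> U U"
    by (rule bij_betw_cong[THEN iffD1, rotated]) (simp add: \<pi>_def)
  then have "\<pi> permutes U" by (rule bij_imp_permutes) (simp add: \<pi>_def)
  moreover have "\<pi> (xs ! j) = ys ! j" if "j < length xs" for j
  proof -
    have j: "X ! j = xs ! j" "Y ! j = ys ! j" "j < N"
      using that assms by (auto simp: X_def Y_def N_def nth_append)
    have "inv_into {..<N} ((!) X) (X ! j) = j"
      using bX j(3) by (simp add: bij_betw_def inv_into_f_f)
    moreover have "xs ! j \<in> U" using that assms(5) nth_mem by blast
    ultimately show ?thesis using j by (simp add: \<pi>_def)
  qed
  then have "map \<pi> xs = ys" using assms(4) by (intro nth_equalityI) auto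
  ultimately show ?thesis by blast
qed

section \<open>The reference product \<open>chi_deg\<close> and comparison of invariant forms with
  it\<close>

definition odds :: "nat \<Rightarrow> nat list" where "odds d = map (\<lambda>i. 2 * i + 1) [0..<d]"

definition evens :: "nat \<Rightarrow> nat list" where "evens d = map (\<lambda>i. 2 * i + 2) [0..<d]"

lemma length_odds [simp]: "length (odds d) = d" and length_evens [simp]: "length (evens d) = d"
  by (simp_all add: odds_def evens_def)

lemma distinct_odds: "distinct (odds d)" and distinct_evens: "distinct (evens d)"
  by (auto simp: odds_def evens_def distinct_map inj_on_def)

lemma odds_evens_disjoint: "set (odds d) \<inter> set (evens d) = {}"
  by (auto simp: odds_def evens_def) presburger

lemma odds_Un_evens: "set (odds d) \<union> set (evens d) = {1..2 * d}"
proof -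
  have "i \<in> set (odds d) \<union> set (evens d)" if i: "i \<in> {1..2 * d}" for i
  proof (cases "even i")
    case True
    then have "i = 2 * ((i - 2) div 2) + 2" "(i - 2) div 2 < d" using i by presburger+
    then show ?thesis unfolding evens_def by auto
  next
    case False
    then have "i = 2 * (i div 2) + 1" "i div 2 < d" using i by presburger+
    then show ?thesis unfolding odds_def by auto
  qed
  moreover have "set (odds d) \<union> set (evens d) \<subseteq> {1..2 * d}"
    by (auto simp: odds_def evens_def)
  ultimately show ?thesis by blast
qed

lemma chi_deg_eq_chi_pair: "chi_deg d = chi_pair (odds d) (evens d)"
proof
  fix x
  have "(\<Prod>i = 1..d. x (2 * i - 1) - x (2 * i)) = (\<Prod>i<d. x (2 * i + 1) - x (2 * i + 2) :: real)"
    by (subst One_nat_def, subst prod.atLeast1_atMost_eq) simp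
  then show "chi_deg d x = chi_pair (odds d) (evens d) x"
    by (simp add: chi_deg_def chi_pair_lessThan odds_def evens_def)
qed

lemma odds_seqs: "2 * d \<le> n \<Longrightarrow> odds d \<in> seqs n d"
  and evens_seqs: "2 * d \<le> n \<Longrightarrow> evens d \<in> seqs n d"
proof -
  assume "2 * d \<le> n"
  then have "set (odds d) \<union> set (evens d) \<subseteq> {1..n}" unfolding odds_Un_evens by simp
  then show "odds d \<in> seqs n d" "evens d \<in> seqs n d"
    by (simp_all add: seqs_def distinct_odds distinct_evens)
qed

lemma chi_deg_chi_span: "2 * d \<le> n \<Longrightarrow> chi_deg d \<in> chi_span n d"
  unfolding chi_deg_eq_chi_pair
  by (intro chi_span.chi odds_seqs evens_seqs odds_evens_disjoint)

lemma (in invariant_form) form_chi_pair_square: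
  assumes "2 * d \<le> n" "A \<in> seqs n d" "B \<in> seqs n d" "set A \<inter> set B = {}"
  shows "L (\<lambda>x. chi_pair A B x * chi_pair A B x) = L (\<lambda>x. chi_deg d x * chi_deg d x)"
proof -
  have "\<exists>\<pi>. \<pi> permutes {1..n} \<and> map \<pi> (odds d @ evens d) = A @ B"
    by (rule permutes_extending_lists)
      (use assms odds_seqs[OF assms(1)] evens_seqs[OF assms(1)] odds_evens_disjoint[of d]
       in \<open>auto simp: seqs_def\<close>)
  then obtain \<pi> where \<pi>: "\<pi> permutes {1..n}" "map \<pi> (odds d) = A" "map \<pi> (evens d) = B"
    using assms by (auto simp: seqs_def)
  have "chi_pair A B = (\<lambda>x. chi_deg d (x \<circ> \<pi>))"
    unfolding chi_deg_eq_chi_pair using \<pi> by (simp add: chi_pair_comp del: fun.map_comp)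
  then show ?thesis
    using form_invariant[OF chi_deg_chi_span chi_deg_chi_span \<pi>(1)] assms(1) by (simp only:)
qed

text \<open>The order of quantifiers matters: \<open>w\<close> is chosen before \<open>L\<close>, so
  it can be read off from one convenient form and used for all others. By linearity only
  \<open>f = chi_pair A B\<close> needs an argument.\<close>

lemma invariant_form_proportional:
  assumes "2 * d \<le> n" "f \<in> chi_span n d" "g \<in> chi_span n d"
  shows "\<exists>w. \<forall>L. invariant_form n d L \<longrightarrow>
    L (\<lambda>x. f x * g x) = w * L (\<lambda>x. chi_deg d x * chi_deg d x)"
  using assms(2)
proof induction
  case (chi A B)
  then have AB: "length A = d" "length B = d" "distinct A" "distinct B"
    "set A \<subseteq> {1..n}" "set B \<subseteq> {1..n}" by (auto simp: seqs_def)
  have fs: "chi_pair A B \<in> chi_span n d" using chi by (rule chi_span.chi)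
  have "g \<in> monom_span {1..n} (length A)" using chi_span_monom_span[OF assms(3)] AB by simp
  then obtain w where w: "\<And>x. alternate A B g x = w * chi_pair A B x"
    using alternate_monom_span[of A B g "{1..n}"] AB chi by auto
  \<comment> \<open>\<open>w\<close> comes from alternating \<open>g\<close>, the power of 2 from
    the antisymmetry of \<open>chi_pair A B\<close>.\<close>
  have "L (\<lambda>x. chi_pair A B x * g x) = w / 2 ^ d * L (\<lambda>x. chi_deg d x * chi_deg d x)"
    if "invariant_form n d L" for L
  proof -
    interpret invariant_form n d L by fact
    have "chi_pair A B (x \<circ> Transposition.transpose a b) = - chi_pair A B x"
      if "(a, b) \<in> set (zip A B)" for a b x
      using that chi_pair_transpose[of A B] AB chi by (auto simp: set_zip simp del: o_apply)
    then have "2 ^ length A * L (\<lambda>x. chi_pair A B x * g x)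
        = L (\<lambda>x. chi_pair A B x * alternate A B g x)"
      using form_alternate[of A B "chi_pair A B" g] AB fs assms(3) by simp
    also have "\<dots> = w * L (\<lambda>x. chi_deg d x * chi_deg d x)"
      unfolding w form_scale[OF fs fs] form_chi_pair_square[OF assms(1) chi] ..
    finally show ?thesis using AB by (simp add: field_simps)
  qed
  then show ?case by blast
next
  case (add f h)
  then obtain w w' where
    w: "\<And>L. invariant_form n d L \<Longrightarrow> L (\<lambda>x. f x * g x) = w * L (\<lambda>x. chi_deg d x * chi_deg d x)"
    "\<And>L. invariant_form n d L \<Longrightarrow> L (\<lambda>x. h x * g x) = w' * L (\<lambda>x. chi_deg d x * chi_deg d x)"
    by blast
  have "L (\<lambda>x. (f x + h x) * g x) = (w + w') * L (\<lambda>x. chi_deg d x * chi_deg d x)"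
    if L: "invariant_form n d L" for L
    using invariant_form.form_add[OF L assms(3) add.hyps] w[OF L]
    by (simp add: mult.commute[of "g _"] distrib_right)
  then show ?case by blast
next
  case (scale f c)
  then obtain w where
    w: "\<And>L. invariant_form n d L \<Longrightarrow> L (\<lambda>x. f x * g x) = w * L (\<lambda>x. chi_deg d x * chi_deg d x)"
    by blast
  have "L (\<lambda>x. c * f x * g x) = c * w * L (\<lambda>x. chi_deg d x * chi_deg d x)"
    if L: "invariant_form n d L" for L
    using invariant_form.form_scale[OF L assms(3) scale.hyps, of c] w[OF L]
    by (simp add: mult.commute[of "g _"])
  then show ?case by blast
qed

section \<open>The discrete cube\<close>

text \<open>Fixing the value outside \<open>{1..n}\<close> as \<open>undefined\<close> makes the
  cube finite, so expectations become sums; they are not normalised, as only ratios matter.\<close>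

definition cube :: "nat \<Rightarrow> (nat \<Rightarrow> real) set" where "cube n = {1..n} \<rightarrow>\<^sub>E {-1, 1}"

lemma finite_cube [simp]: "finite (cube n)"
  by (simp add: cube_def finite_PiE)

lemma cube_cases:
  assumes "x \<in> cube n" "i \<in> {1..n}"
  shows "x i = 1 \<or> x i = -1"
  using PiE_mem[of x "{1..n}" "\<lambda>_. {-1, 1}" i] assms by (auto simp: cube_def)

lemma cube_square: "x \<in> cube n \<Longrightarrow> i \<in> {1..n} \<Longrightarrow> x i * x i = 1"
  using cube_cases[of x n i] by auto

lemma cube_comp_permutes:
  assumes "x \<in> cube n" "\<pi> permutes {1..n}"
  shows "x \<circ> \<pi> \<in> cube n"
proof -
  have "x (\<pi> i) \<in> {-1, 1}" if "i \<in> {1..n}" for i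
  proof -
    have "\<pi> i \<in> {1..n}" using that by (simp only: permutes_in_image[OF assms(2)])
    from cube_cases[OF assms(1) this] show ?thesis by blast
  qed
  moreover have "x (\<pi> i) = undefined" if "i \<notin> {1..n}" for i
    unfolding permutes_not_in[OF assms(2) that]
    using assms(1) that unfolding cube_def by (rule PiE_arb)
  ultimately show ?thesis by (simp add: cube_def PiE_iff extensional_def)
qed

lemma sum_cube_permutes:
  assumes "\<pi> permutes {1..n}"
  shows "(\<Sum>x\<in>cube n. F (x \<circ> \<pi>)) = (\<Sum>x\<in>cube n. F x :: real)"
proof (rule sum.reindex_bij_witness[of _ "\<lambda>x. x \<circ> inv \<pi>" "\<lambda>x. x \<circ> \<pi>"])
  show "x \<circ> \<pi> \<circ> inv \<pi> = x" "x \<circ> inv \<pi> \<circ> \<pi> = x" for x :: "nat \<Rightarrow> real"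
    by (simp_all only: comp_assoc permutes_inv_o[OF assms] comp_id)
  show "x \<circ> \<pi> \<in> cube n" "x \<circ> inv \<pi> \<in> cube n" if "x \<in> cube n" for x
    by (fact cube_comp_permutes[OF that assms] cube_comp_permutes[OF that permutes_inv[OF assms]])+
qed (rule refl)

lemma cube_flip:
  assumes "x \<in> cube n" "i \<in> {1..n}"
  shows "x(i := - x i) \<in> cube n"
proof -
  have "- x i \<in> {-1, 1}" using cube_cases[OF assms] by auto
  then have "x(i := - x i) \<in> insert i {1..n} \<rightarrow>\<^sub>E {-1, 1}"
    using assms(1) unfolding cube_def by (rule PiE_fun_upd)
  then show ?thesis using assms(2) by (simp add: cube_def insert_absorb)
qed

text \<open>Flipping the sign of \<open>x i\<close> is an involution of the cube. This replaces
  arguments by independence and mean zero of the coordinates.\<close>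

lemma sum_cube_odd:
  assumes "i \<in> {1..n}" "\<And>x. x \<in> cube n \<Longrightarrow> F (x(i := - x i)) = - F x"
  shows "(\<Sum>x\<in>cube n. F x) = (0::real)"
proof -
  have "(\<Sum>x\<in>cube n. F x) = (\<Sum>x\<in>cube n. - F x)"
  proof (rule sum.reindex_bij_witness[of _ "\<lambda>x. x(i := - x i)" "\<lambda>x. x(i := - x i)"])
    show "x(i := - x i) \<in> cube n" if "x \<in> cube n" for x
      using that assms(1) by (rule cube_flip)
    then show "x(i := - x i) \<in> cube n" if "x \<in> cube n" for x
      using that .
    show "- F (x(i := - x i)) = F x" if "x \<in> cube n" for x
      using assms(2)[OF that] by simp
  qed simp_all
  then show ?thesis by (simp add: sum_negf)
qed

text \<open>The cube may have more coordinates than the form: the weight only has to be symmetric in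
  the first \<open>m\<close> of them.\<close>

lemma invariant_form_cube:
  assumes "m \<le> n" "\<And>\<pi> x. \<pi> permutes {1..m} \<Longrightarrow> W (x \<circ> \<pi>) = W x"
  shows "invariant_form m d (\<lambda>f. \<Sum>x\<in>cube n. W x * f x)"
proof
  fix f g :: "(nat \<Rightarrow> real) \<Rightarrow> real" and \<pi> :: "nat \<Rightarrow> nat"
  assume \<pi>: "\<pi> permutes {1..m}"
  then have "\<pi> permutes {1..n}" by (rule permutes_subset) (use assms(1) in auto)
  from sum_cube_permutes[OF this, of "\<lambda>x. W x * (f x * g x)"]
  show "(\<Sum>x\<in>cube n. W x * (f (x \<circ> \<pi>) * g (x \<circ> \<pi>))) = (\<Sum>x\<in>cube n. W x * (f x * g x))"
    by (simp only: assms(2)[OF \<pi>])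
qed (simp_all add: sum.distrib sum_distrib_left algebra_simps)

lemma sum_nth: "distinct A \<Longrightarrow> (\<Sum>a\<in>set A. f a) = (\<Sum>i<length A. f (A ! i) :: real)"
  using sum.reindex_bij_betw[OF bij_betw_nth[of A "{..<length A}" "set A"], of f] by simp

text \<open>Where \<open>\<chi>\<^bsub>A,B\<^esub>\<close> does not vanish on the cube, the two coordinates of each pair are opposite.\<close>

lemma cube_chi_pair_sum:
  assumes "x \<in> cube n" "length A = length B" "distinct A" "distinct B" "set A \<inter> set B = {}"
    "set A \<subseteq> {1..n}" "set B \<subseteq> {1..n}"
  shows "chi_pair A B x * (\<Sum>a\<in>set A \<union> set B. x a) = 0"
proof (cases "chi_pair A B x = 0")
  case False
  have "x (A ! i) + x (B ! i) = 0" if "i < length B" for i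
  proof -
    have "x (A ! i) \<noteq> x (B ! i)" using False that by (auto simp: chi_pair_lessThan)
    moreover have "A ! i \<in> {1..n}" "B ! i \<in> {1..n}"
      using assms that by (auto simp: subset_iff)
    ultimately show ?thesis using cube_cases[OF assms(1), of "A ! i"] cube_cases[OF assms(1), of "B ! i"] by auto
  qed
  then have "(\<Sum>i<length B. x (A ! i) + x (B ! i)) = 0" by simp
  then have "(\<Sum>a\<in>set A \<union> set B. x a) = 0"
    using assms by (simp add: sum.union_disjoint sum_nth sum.distrib)
  then show ?thesis by simp
qed simp

text \<open>The sum over \<open>set A \<union> set B\<close> is killed by
  \<open>chi_pair A B\<close>, so it may be added for free. The resulting factor no longer depends
  on \<open>A\<close> or \<open>B\<close>.\<close>

lemma chi_pair_mult_sum_cube: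
  assumes "x \<in> cube n" "length A = length B" "distinct A" "distinct B" "set A \<inter> set B = {}"
    "set A \<union> set B \<subseteq> {1..<m}" "m \<le> n"
  shows "chi_pair A B x * (\<Sum>a\<in>{1..<m} - (set A \<union> set B). x a)
    = chi_pair A B x * (\<Sum>a\<in>{1..<m}. x a)"
proof -
  have "(\<Sum>a\<in>{1..<m}. x a) = (\<Sum>a\<in>{1..<m} - (set A \<union> set B). x a) + (\<Sum>a\<in>set A \<union> set B. x a)"
    using assms(6) by (intro sum.subset_diff) auto
  moreover have "set A \<subseteq> {1..n}" "set B \<subseteq> {1..n}" using assms(6,7) by force+
  ultimately show ?thesis
    using cube_chi_pair_sum[OF assms(1-5)] by (simp add: distrib_left)
qed

lemma chi_deg_upd: "i > 2 * d \<Longrightarrow> chi_deg d (x(i := t)) = chi_deg d x"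
  by (rule chi_span_cong[OF chi_deg_chi_span[of d "2 * d"]]) auto

text \<open>Coordinates beyond \<open>2 * d\<close> do not occur in \<open>chi_deg d\<close>:
  distinct ones are orthogonal by oddness in \<open>x i\<close>, equal ones multiply to 1.\<close>

lemma sum_cube_chi_deg_pair:
  assumes "i \<in> {2 * d<..n}" "j \<in> {2 * d<..n}"
  shows "(\<Sum>x\<in>cube n. x i * x j * (chi_deg d x * chi_deg d x))
    = (if i = j then \<Sum>x\<in>cube n. chi_deg d x * chi_deg d x else 0)"
proof (cases "i = j")
  case True
  have "x i * x j * (chi_deg d x * chi_deg d x) = chi_deg d x * chi_deg d x" if "x \<in> cube n" for x
    using cube_square[OF that, of i] assms True by simp
  then have "(\<Sum>x\<in>cube n. x i * x j * (chi_deg d x * chi_deg d x))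
      = (\<Sum>x\<in>cube n. chi_deg d x * chi_deg d x)" by (rule sum.cong[OF refl])
  then show ?thesis using True by simp
next
  case False
  have "(\<Sum>x\<in>cube n. x i * x j * (chi_deg d x * chi_deg d x)) = 0"
    by (rule sum_cube_odd[of i]) (use assms False in \<open>auto simp: chi_deg_upd\<close>)
  then show ?thesis using False by simp
qed

text \<open>In the square of the new factor the two squares contribute 1 each and the mixed term
  vanishes.\<close>

lemma sum_cube_chi_deg_Suc:
  assumes "2 * Suc d \<le> n"
  shows "(\<Sum>x\<in>cube n. chi_deg (Suc d) x * chi_deg (Suc d) x)
    = 2 * (\<Sum>x\<in>cube n. chi_deg d x * chi_deg d x)"
proof -
  let ?i = "2 * d + 1" and ?j = "2 * d + 2"
  let ?q = "\<lambda>x. chi_deg d x * chi_deg d x"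
  have Suc: "chi_deg (Suc d) x = chi_deg d x * (x ?i - x ?j)" for x
    by (simp add: chi_deg_def)
  have "(\<Sum>x\<in>cube n. chi_deg (Suc d) x * chi_deg (Suc d) x)
      = (\<Sum>x\<in>cube n. x ?i * x ?i * ?q x + x ?j * x ?j * ?q x - 2 * (x ?i * x ?j * ?q x))"
    unfolding Suc by (simp add: algebra_simps)
  also have "\<dots> = (\<Sum>x\<in>cube n. x ?i * x ?i * ?q x) + (\<Sum>x\<in>cube n. x ?j * x ?j * ?q x)
      - 2 * (\<Sum>x\<in>cube n. x ?i * x ?j * ?q x)"
    by (simp only: sum.distrib sum_subtractf sum_distrib_left)
  also have "\<dots> = 2 * (\<Sum>x\<in>cube n. ?q x)"
    using assms by (simp add: sum_cube_chi_deg_pair del: One_nat_def add_2_eq_Suc' Suc_1)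
  finally show ?thesis .
qed

text \<open>Allows cancelling the norm of \<open>chi_deg d\<close> when a constant is read off from
  the cube.\<close>

lemma sum_cube_chi_deg_pos: "2 * d \<le> n \<Longrightarrow> (\<Sum>x\<in>cube n. chi_deg d x * chi_deg d x) > 0"
proof (induction d)
  case 0
  have "(\<lambda>i\<in>{1..n}. 1) \<in> cube n" by (simp add: cube_def)
  then have "card (cube n) > 0" by (auto simp: card_gt_0_iff)
  then show ?case by (simp add: chi_deg_def)
next
  case (Suc d)
  then show ?case by (simp add: sum_cube_chi_deg_Suc)
qed

text \<open>Against \<open>chi_deg d\<close> the coordinates up to \<open>2 * d\<close> drop out of
  the sum; of the square of the rest only the \<open>m - 1 - 2 * d\<close> diagonal terms
  survive.\<close>

lemma sum_cube_weighted_chi_deg: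
  assumes "2 * d < m" "m \<le> n"
  shows "(\<Sum>x\<in>cube n. (\<Sum>i\<in>{1..<m}. x i)\<^sup>2 * (chi_deg d x * chi_deg d x))
    = (real m - 1 - 2 * real d) * (\<Sum>x\<in>cube n. chi_deg d x * chi_deg d x)"
proof -
  let ?q = "\<lambda>x. chi_deg d x * chi_deg d x"
  let ?T = "{1..<m} - {1..2 * d}"
  have T: "?T \<subseteq> {2 * d<..n}" using assms by auto
  have "(\<Sum>i\<in>{1..<m}. x i)\<^sup>2 * ?q x = (\<Sum>i\<in>?T. \<Sum>j\<in>?T. x i * x j * ?q x)" if "x \<in> cube n" for x
  proof -
    have "chi_deg d x * (\<Sum>a\<in>?T. x a) = chi_deg d x * (\<Sum>a\<in>{1..<m}. x a)"
      using chi_pair_mult_sum_cube[OF that _ distinct_odds distinct_evens odds_evens_disjoint, of d m]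
        assms
      unfolding odds_Un_evens chi_deg_eq_chi_pair by force
    then have "(\<Sum>i\<in>{1..<m}. x i)\<^sup>2 * ?q x = (\<Sum>i\<in>?T. x i)\<^sup>2 * ?q x"
      by (auto simp: power2_eq_square)
    also have "\<dots> = (\<Sum>i\<in>?T. \<Sum>j\<in>?T. x i * x j * ?q x)"
      by (subst power2_eq_square, subst sum_product) (simp only: sum_distrib_right)
    finally show ?thesis .
  qed
  then have "(\<Sum>x\<in>cube n. (\<Sum>i\<in>{1..<m}. x i)\<^sup>2 * ?q x)
      = (\<Sum>x\<in>cube n. \<Sum>i\<in>?T. \<Sum>j\<in>?T. x i * x j * ?q x)" by simp
  also have "\<dots> = (\<Sum>i\<in>?T. \<Sum>j\<in>?T. \<Sum>x\<in>cube n. x i * x j * ?q x)"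
    by (subst sum.swap, intro sum.cong refl, subst sum.swap, rule refl)
  also have "\<dots> = (\<Sum>i\<in>?T. \<Sum>j\<in>?T. if i = j then \<Sum>x\<in>cube n. ?q x else 0)"
    by (intro sum.cong refl sum_cube_chi_deg_pair) (use T in blast)+
  also have "\<dots> = real (card ?T) * (\<Sum>x\<in>cube n. ?q x)"
    by (simp del: Diff_iff)
  also have "real (card ?T) = real m - 1 - 2 * real d"
    using assms by (subst card_Diff_subset) auto
  finally show ?thesis .
qed

section \<open>The squared norm on the cube\<close>

text \<open>Formulated without \<open>n\<close>, for induction on \<open>B\<close>: the entries are
  bounded above by those of \<open>B\<close>, so only 0 has to be excluded.\<close>

definition lowers :: "nat list \<Rightarrow> nat list set" where
  "lowers B = {A. distinct A \<and> 0 \<notin> set A \<and> set A \<inter> set B = {} \<and> list_all2 (<) A B}"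

lemma list_all2_less_bound:
  assumes "list_all2 (<) A B" "\<And>b. b \<in> set B \<Longrightarrow> b \<le> m" "a \<in> set A"
  shows "a < (m::nat)"
proof -
  obtain i where i: "i < length A" "a = A ! i" using assms(3) by (auto simp: in_set_conv_nth)
  then have "A ! i < B ! i" "B ! i \<in> set B"
    using assms(1) by (auto simp: list_all2_conv_all_nth)
  then show ?thesis using assms(2) i by force
qed

lemma lowersD:
  assumes "A \<in> lowers B" "distinct B" "set B \<subseteq> {1..m}"
  shows "length A = length B" "set A \<inter> set B = {}" "A \<in> seqs m (length B)" "B \<in> seqs m (length B)"
proof -
  have A: "distinct A" "0 \<notin> set A" "set A \<inter> set B = {}" "list_all2 (<) A B"
    using assms(1) by (auto simp: lowers_def)
  have "a \<le> m" if "a \<in> set A" for a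
    by (rule less_imp_le, rule list_all2_less_bound[OF A(4) _ that]) (use assms(3) in auto)
  moreover have "1 \<le> a" if "a \<in> set A" for a
    using A(2) that by (cases a) auto
  ultimately have "set A \<subseteq> {1..m}" by auto
  then show "length A = length B" "set A \<inter> set B = {}"
    "A \<in> seqs m (length B)" "B \<in> seqs m (length B)"
    using A assms(2,3) by (auto simp: seqs_def list_all2_lengthD)
qed

lemma lowers_eq_seqs:
  assumes "distinct B" "set B \<subseteq> {1..n}"
  shows "lowers B = {A \<in> seqs n (length B). set A \<inter> set B = {} \<and> seq_less A B}"
proof (intro equalityI subsetI)
  fix A assume "A \<in> lowers B"
  with lowersD[OF this assms] show "A \<in> {A \<in> seqs n (length B). set A \<inter> set B = {} \<and> seq_less A B}"
    by (simp add: lowers_def seq_less_def)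
next
  fix A assume "A \<in> {A \<in> seqs n (length B). set A \<inter> set B = {} \<and> seq_less A B}"
  then show "A \<in> lowers B" by (auto simp: lowers_def seq_less_def seqs_def)
qed

lemma finite_seqs: "finite (seqs n d)"
  by (rule finite_subset[OF _ finite_lists_length_eq[of "{1..n}" d]]) (auto simp: seqs_def)

lemma chi_top_lowers:
  assumes "distinct B" "set B \<subseteq> {1..n}"
  shows "chi_top n B = (\<lambda>x. \<Sum>A\<in>lowers B. chi_pair A B x)"
  using lowers_eq_seqs[OF assms] by (simp add: chi_top_def fun_eq_iff)

text \<open>Any bound \<open>m\<close> on the entries of \<open>B\<close> will do; a small one shows
  that later variables do not occur.\<close>

lemma chi_top_chi_span:
  assumes "distinct B" "set B \<subseteq> {1..m}" "lowers B \<noteq> {}"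
  shows "(\<lambda>x. \<Sum>A\<in>lowers B. chi_pair A B x) \<in> chi_span m (length B)"
proof (rule chi_span_sum)
  show "finite (lowers B)" using finite_seqs lowers_eq_seqs[OF assms(1,2)] by simp
  show "chi_pair A B \<in> chi_span m (length B)" if "A \<in> lowers B" for A
    using lowersD[OF that assms(1,2)] by (intro chi_span.chi)
qed fact

text \<open>As \<open>B\<close> increases to \<open>m\<close>, the entries of \<open>A\<close> stay
  below \<open>m\<close>, and the partner of \<open>m\<close> is any smaller positive index still
  free.\<close>

lemma lowers_snoc:
  assumes "sorted_wrt (<) (B @ [m])"
  shows "lowers (B @ [m])
    = (\<lambda>(A, a). A @ [a]) ` (SIGMA A:lowers B. {1..<m} - (set A \<union> set B))"
proof (intro equalityI subsetI)
  fix A' assume A': "A' \<in> lowers (B @ [m])"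
  then have "list_all2 (<) A' (B @ [m])" by (simp add: lowers_def)
  then obtain A a where "A' = A @ [a]" "list_all2 (<) A B" "a < m"
    by (auto simp: list_all2_append2 list_all2_Cons2)
  moreover from this have "A \<in> lowers B" "a \<in> {1..<m} - (set A \<union> set B)"
    using A' by (auto simp: lowers_def Suc_le_eq intro: gr0I)
  ultimately show "A' \<in> (\<lambda>(A, a). A @ [a]) ` (SIGMA A:lowers B. {1..<m} - (set A \<union> set B))"
    by force
next
  fix A' assume "A' \<in> (\<lambda>(A, a). A @ [a]) ` (SIGMA A:lowers B. {1..<m} - (set A \<union> set B))"
  then obtain p where p: "p \<in> (SIGMA A:lowers B. {1..<m} - (set A \<union> set B))"
    "A' = (\<lambda>(A, a). A @ [a]) p" by blast
  obtain A a where "p = (A, a)" by (cases p)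
  with p have A: "A \<in> lowers B" "A' = A @ [a]" "a \<in> {1..<m} - (set A \<union> set B)" by simp_all
  have "c < m" if "c \<in> set A" for c
    by (rule list_all2_less_bound[of A B]) (use A that assms in \<open>auto simp: lowers_def sorted_wrt_append less_imp_le\<close>)
  then have "m \<notin> set A" by blast
  then show "A' \<in> lowers (B @ [m])" using A by (auto simp: lowers_def list_all2_appendI)
qed

lemma strict_sorted_snoc:
  fixes B :: "nat list"
  assumes "sorted_wrt (<) (B @ [m])" "set (B @ [m]) \<subseteq> {1..n}"
  shows "sorted_wrt (<) B" "distinct B" "set B \<subseteq> {1..m - 1}" "1 \<le> m" "m \<le> n"
proof -
  show B: "sorted_wrt (<) B" "1 \<le> m" "m \<le> n"
    using assms by (auto simp: sorted_wrt_append)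
  show "distinct B" using B(1) by (simp add: strict_sorted_iff)
  have "b < m" "1 \<le> b" if "b \<in> set B" for b
    using assms that by (auto simp: sorted_wrt_append)
  then show "set B \<subseteq> {1..m - 1}" by fastforce
qed

text \<open>Every \<open>A\<close> leaves the same number \<open>m - 1 - 2 * length B\<close> of
  partners for \<open>m\<close>, and on the cube the sum of the free coordinates may be replaced by
  that of all below \<open>m\<close>. Hence a common factor comes out of the sum over
  \<open>A\<close>.\<close>

lemma chi_top_snoc_cube:
  assumes "sorted_wrt (<) (B @ [m])" "set (B @ [m]) \<subseteq> {1..n}" "x \<in> cube n"
  shows "(\<Sum>A\<in>lowers (B @ [m]). chi_pair A (B @ [m]) x)
    = (\<Sum>A\<in>lowers B. chi_pair A B x)
      * ((\<Sum>a\<in>{1..<m}. x a) - (real m - 1 - 2 * real (length B)) * x m)"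
proof -
  let ?R = "\<lambda>A. {1..<m} - (set A \<union> set B)"
  note B = strict_sorted_snoc(2,3)[OF assms(1,2)] and m = strict_sorted_snoc(4,5)[OF assms(1,2)]
  have fin: "finite (lowers B)" using finite_seqs lowers_eq_seqs[OF B] by simp
  have "(\<Sum>A\<in>lowers (B @ [m]). chi_pair A (B @ [m]) x)
      = (\<Sum>(A, a)\<in>(SIGMA A:lowers B. ?R A). chi_pair (A @ [a]) (B @ [m]) x)"
    unfolding lowers_snoc[OF assms(1)]
    by (subst sum.reindex) (auto simp: inj_on_def case_prod_unfold)
  also have "\<dots> = (\<Sum>A\<in>lowers B. \<Sum>a\<in>?R A. chi_pair (A @ [a]) (B @ [m]) x)"
    using fin by (subst sum.Sigma) auto
  also have "\<dots> = (\<Sum>A\<in>lowers B. chi_pair A B x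
      * ((\<Sum>a\<in>{1..<m}. x a) - (real m - 1 - 2 * real (length B)) * x m))"
  proof (rule sum.cong[OF refl])
    fix A assume "A \<in> lowers B"
    note A = lowersD[OF this B]
    have dA: "distinct A" using A by (simp add: seqs_def)
    have "set A \<union> set B \<subseteq> {1..m - 1}" using A B by (simp add: seqs_def)
    also have "{1..m - 1} = {1..<m}" using m by auto
    finally have sub: "set A \<union> set B \<subseteq> {1..<m}" .
    have "card (set A \<union> set B) = 2 * length B"
      using A dA B(1) by (simp add: card_Un_disjoint distinct_card)
    moreover have "card (set A \<union> set B) \<le> m - 1"
      using card_mono[OF _ sub] by simp
    moreover have "card (?R A) = m - 1 - card (set A \<union> set B)"
      using sub by (subst card_Diff_subset) auto
    ultimately have card: "real (card (?R A)) = real m - 1 - 2 * real (length B)"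
      using m by (simp add: of_nat_diff)
    have "(\<Sum>a\<in>?R A. chi_pair (A @ [a]) (B @ [m]) x) = (\<Sum>a\<in>?R A. chi_pair A B x * (x a - x m))"
      using A(1) by (simp add: chi_pair_snoc)
    also have "\<dots> = chi_pair A B x * (\<Sum>a\<in>?R A. x a) - chi_pair A B x * (real (card (?R A)) * x m)"
      by (simp only: sum_distrib_left[symmetric] sum_subtractf sum_constant right_diff_distrib)
    also have "\<dots> = chi_pair A B x
        * ((\<Sum>a\<in>{1..<m}. x a) - (real m - 1 - 2 * real (length B)) * x m)"
      unfolding card chi_pair_mult_sum_cube[OF assms(3) A(1) dA B(1) A(2) sub m(2)]
      by (simp only: right_diff_distrib)
    finally show "(\<Sum>a\<in>?R A. chi_pair (A @ [a]) (B @ [m]) x) = chi_pair A B x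
        * ((\<Sum>a\<in>{1..<m}. x a) - (real m - 1 - 2 * real (length B)) * x m)" .
  qed
  finally show ?thesis by (simp add: sum_distrib_right)
qed

lemma c_coeff_snoc:
  "c_coeff (B @ [m]) = c_coeff B
    * ((real m - 2 * real (length B)) * (real m - 2 * real (length B) - 1) / 2)"
proof -
  have "(\<Prod>i = 1..length B. (real ((B @ [m]) ! (i - 1)) - 2 * (real i - 1))
        * (real ((B @ [m]) ! (i - 1)) - 2 * (real i - 1) - 1) / 2) = c_coeff B"
    unfolding c_coeff_def by (intro prod.cong) (auto simp: nth_append)
  then show ?thesis by (simp add: c_coeff_def)
qed

lemma lowers_nonempty_bound:
  assumes "A \<in> lowers B" "distinct B" "set B \<subseteq> {1..m}"
  shows "2 * length B \<le> m"
proof -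
  note A = lowersD[OF assms]
  have "card (set A \<union> set B) \<le> card {1..m}"
    using A by (intro card_mono) (auto simp: seqs_def)
  then show ?thesis
    using A by (simp add: seqs_def card_Un_disjoint distinct_card)
qed

lemma sum_cube_chi_top:
  assumes "sorted_wrt (<) B" "set B \<subseteq> {1..n}" "lowers B \<noteq> {}"
  shows "(\<Sum>x\<in>cube n. (\<Sum>A\<in>lowers B. chi_pair A B x) * (\<Sum>A\<in>lowers B. chi_pair A B x))
    = c_coeff B * (\<Sum>x\<in>cube n. chi_deg (length B) x * chi_deg (length B) x)"
  using assms
proof (induction B rule: rev_induct)
  case Nil
  have "lowers [] = {[]}" by (auto simp: lowers_def)
  then show ?case by (simp add: chi_deg_def c_coeff_def)
next
  case (snoc m B)
  define d where "d = length B"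
  define f where "f x = (\<Sum>A\<in>lowers B. chi_pair A B x)" for x
  define q where "q x = chi_deg d x * chi_deg d x" for x
  define S where "S x = (\<Sum>a\<in>{1..<m}. x a)" for x :: "nat \<Rightarrow> real"
  \<comment> \<open>The number of partners for \<open>m\<close>; \<open>d\<close> is the length of
    \<open>B\<close> without \<open>m\<close>.\<close>
  define k where "k = real m - 1 - 2 * real d"
  note sB = strict_sorted_snoc(1)[OF snoc.prems(1,2)]
    and B = strict_sorted_snoc(2,3)[OF snoc.prems(1,2)]
    and m = strict_sorted_snoc(4,5)[OF snoc.prems(1,2)]
  have ne: "lowers B \<noteq> {}" using snoc.prems(3) unfolding lowers_snoc[OF snoc.prems(1)] by auto
  then have d: "2 * d \<le> m - 1" using lowers_nonempty_bound B by (auto simp: d_def)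
  have "2 * length (B @ [m]) \<le> n"
  proof -
    obtain A where "A \<in> lowers (B @ [m])" using snoc.prems(3) by blast
    then show ?thesis
      by (rule lowers_nonempty_bound) (use snoc.prems in \<open>auto simp: strict_sorted_iff\<close>)
  qed
  then have dn: "2 * Suc d \<le> n" by (simp add: d_def)
  have f: "f \<in> chi_span (m - 1) d"
    using chi_top_chi_span[OF B ne] by (simp add: f_def[abs_def] d_def)
  \<comment> \<open>Invariance in the first \<open>m - 1\<close> variables suffices, as
    \<open>f\<close> involves no others; this admits both weights 1 and
    \<open>(S x)\<^sup>2\<close>.\<close>
  obtain w where w: "\<And>L. invariant_form (m - 1) d L \<Longrightarrow>
      L (\<lambda>x. f x * f x) = w * L (\<lambda>x. chi_deg d x * chi_deg d x)"
    using invariant_form_proportional[OF d f f] by blast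
  have S_perm: "S (x \<circ> \<pi>) = S x" if "\<pi> permutes {1..m - 1}" for \<pi> x
  proof -
    have "{1..<m} = {1..m - 1}" using m by auto
    then show ?thesis using sum.permute[OF that, of x] by (simp add: S_def)
  qed
  have "m - 1 \<le> n" using m by simp
  from w[OF invariant_form_cube[OF this, of "\<lambda>_. 1"]]
  have w0: "(\<Sum>x\<in>cube n. f x * f x) = w * (\<Sum>x\<in>cube n. q x)" by (simp add: q_def)
  from w[OF invariant_form_cube[OF \<open>m - 1 \<le> n\<close>, of "\<lambda>x. (S x)\<^sup>2"]]
  have "(\<Sum>x\<in>cube n. (S x)\<^sup>2 * (f x * f x)) = w * (\<Sum>x\<in>cube n. (S x)\<^sup>2 * q x)"
    by (simp add: S_perm q_def del: o_apply)
  also have "(\<Sum>x\<in>cube n. (S x)\<^sup>2 * q x) = k * (\<Sum>x\<in>cube n. q x)"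
    using sum_cube_weighted_chi_deg[of d m n] d m unfolding S_def q_def k_def by simp
  \<comment> \<open>Comparing the two weights eliminates the unknown \<open>w\<close>.\<close>
  finally have w1: "(\<Sum>x\<in>cube n. (S x)\<^sup>2 * (f x * f x)) = k * (\<Sum>x\<in>cube n. f x * f x)"
    using w0 by simp
  \<comment> \<open>The mixed term is odd in \<open>x m\<close>, which occurs in neither
    \<open>S\<close> nor \<open>f\<close>.\<close>
  have cross: "(\<Sum>x\<in>cube n. x m * (S x * (f x * f x))) = 0"
  proof (rule sum_cube_odd[of m])
    fix x :: "nat \<Rightarrow> real"
    have "f (x(m := - x m)) = f x" by (rule chi_span_cong[OF f]) (use m in auto)
    moreover have "S (x(m := - x m)) = S x" unfolding S_def by (intro sum.cong) auto
    ultimately show "(x(m := - x m)) m * (S (x(m := - x m)) * (f (x(m := - x m)) * f (x(m := - x m))))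
        = - (x m * (S x * (f x * f x)))" by simp
  qed (use m in auto)
  have "(\<Sum>x\<in>cube n. (\<Sum>A\<in>lowers (B @ [m]). chi_pair A (B @ [m]) x)
        * (\<Sum>A\<in>lowers (B @ [m]). chi_pair A (B @ [m]) x))
      = (\<Sum>x\<in>cube n. (S x)\<^sup>2 * (f x * f x) - 2 * k * (x m * (S x * (f x * f x))) + k\<^sup>2 * (f x * f x))"
  proof (rule sum.cong[OF refl])
    fix x assume x: "x \<in> cube n"
    have top: "(\<Sum>A\<in>lowers (B @ [m]). chi_pair A (B @ [m]) x) = f x * (S x - k * x m)"
      using chi_top_snoc_cube[OF snoc.prems(1,2) x] by (simp add: f_def S_def k_def d_def)
    have "(f x * (S x - k * x m)) * (f x * (S x - k * x m))
        = (S x)\<^sup>2 * (f x * f x) - 2 * k * (x m * (S x * (f x * f x))) + k\<^sup>2 * (f x * f x) * (x m * x m)"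
      by (simp add: power2_eq_square algebra_simps)
    then show "(\<Sum>A\<in>lowers (B @ [m]). chi_pair A (B @ [m]) x)
        * (\<Sum>A\<in>lowers (B @ [m]). chi_pair A (B @ [m]) x)
      = (S x)\<^sup>2 * (f x * f x) - 2 * k * (x m * (S x * (f x * f x))) + k\<^sup>2 * (f x * f x)"
      unfolding top using cube_square[OF x, of m] m by simp
  qed
  also have "\<dots> = (k + k\<^sup>2) * (\<Sum>x\<in>cube n. f x * f x)"
    by (simp add: sum.distrib sum_subtractf w1 cross distrib_right flip: sum_distrib_left)
  also have "(\<Sum>x\<in>cube n. f x * f x) = c_coeff B * (\<Sum>x\<in>cube n. q x)"
    using snoc.IH[OF sB _ ne] snoc.prems(2) by (simp add: f_def q_def d_def)
  also have "(\<Sum>x\<in>cube n. q x) = (\<Sum>x\<in>cube n. chi_deg (Suc d) x * chi_deg (Suc d) x) / 2"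
    using sum_cube_chi_deg_Suc[OF dn] by (simp add: q_def)
  \<comment> \<open>With \<open>k + 1 = m - 2 * d\<close>, the factor
    \<open>(k + k\<^sup>2) / 2\<close> is the last factor of \<open>c_coeff\<close>.\<close>
  finally show ?case
    by (simp add: c_coeff_snoc k_def d_def power2_eq_square field_simps)
qed

section \<open>Exchangeable measures\<close>

lemma integrable_chi_span:
  assumes int: "\<And>f g. f \<in> harmonic_multilinear n \<Longrightarrow> g \<in> harmonic_multilinear n
      \<Longrightarrow> integrable \<mu> (\<lambda>x. f x * g x)"
    and "f \<in> chi_span n d" "g \<in> chi_span n d"
  shows "integrable \<mu> (\<lambda>x. f x * g x :: real)"
  using assms(2)
proof induction
  case (chi A B)
  show ?case using assms(3)
  proof induction
    case (chi C D)
    then show ?case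
      by (intro int chi_pair_harmonic[of A n d B] chi_pair_harmonic[of C n d D] \<open>A \<in> seqs n d\<close> \<open>B \<in> seqs n d\<close> \<open>set A \<inter> set B = {}\<close>)
  next
    case (scale g c)
    then have "integrable \<mu> (\<lambda>x. c * (chi_pair A B x * g x))" by simp
    then show ?case by (simp only: mult.left_commute[of c])
  qed (simp add: distrib_left)
qed (simp_all add: distrib_right mult.assoc)

lemma invariant_form_exchangeable:
  assumes "exchangeable n \<mu>"
    and int: "\<And>f g. f \<in> harmonic_multilinear n \<Longrightarrow> g \<in> harmonic_multilinear n
      \<Longrightarrow> integrable \<mu> (\<lambda>x. f x * g x)"
  shows "invariant_form n d (\<lambda>f. LINT x|\<mu>. f x)"
proof
  have int': "integrable \<mu> (\<lambda>x. f x * g x)" if "f \<in> chi_span n d" "g \<in> chi_span n d" for f g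
    by (rule integrable_chi_span[OF _ that]) (rule int)
  fix f g h :: "(nat \<Rightarrow> real) \<Rightarrow> real" and c :: real
  assume f: "f \<in> chi_span n d" and g: "g \<in> chi_span n d"
  show "(LINT x|\<mu>. f x * (c * g x)) = c * (LINT x|\<mu>. f x * g x)"
    by (simp add: mult.left_commute)
  show "(LINT x|\<mu>. f x * (g x + h x)) = (LINT x|\<mu>. f x * g x) + (LINT x|\<mu>. f x * h x)"
    if "h \<in> chi_span n d"
    using int'[OF f g] int'[OF f that] by (simp add: distrib_left)
  show "(LINT x|\<mu>. f (x \<circ> \<pi>) * g (x \<circ> \<pi>)) = (LINT x|\<mu>. f x * g x)"
    if \<pi>: "\<pi> permutes {1..n}" for \<pi>
  proof -
    let ?T = "\<lambda>x. \<lambda>i\<in>{1..n}. x (\<pi> i)"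
    have sets: "sets \<mu> = sets (\<Pi>\<^sub>M i\<in>{1..n}. (borel :: real measure))"
      and distr: "distr \<mu> \<mu> ?T = \<mu>"
      using assms(1) \<pi> by (auto simp: exchangeable_def)
    have "?T \<in> (\<Pi>\<^sub>M i\<in>{1..n}. (borel :: real measure)) \<rightarrow>\<^sub>M (\<Pi>\<^sub>M i\<in>{1..n}. borel)"
      by (intro measurable_restrict measurable_component_singleton)
        (simp only: permutes_in_image[OF \<pi>])
    then have T: "?T \<in> \<mu> \<rightarrow>\<^sub>M \<mu>"
      unfolding measurable_cong_sets[OF sets sets] .
    \<comment> \<open>\<open>?T x\<close> and \<open>x \<circ> \<pi>\<close> can differ only outside
      \<open>{1..n}\<close>, where elements of \<open>chi_span\<close> do not look.\<close>
    have eq: "h (x \<circ> \<pi>) = h (?T x)" if "h \<in> chi_span n d" for h and x :: "nat \<Rightarrow> real"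
      by (rule chi_span_cong[OF that]) simp
    have "(LINT x|\<mu>. f (x \<circ> \<pi>) * g (x \<circ> \<pi>)) = (LINT x|\<mu>. f (?T x) * g (?T x))"
      unfolding eq[OF f] eq[OF g] ..
    also have "\<dots> = (LINT x|distr \<mu> \<mu> ?T. f x * g x)"
      using integral_distr[OF T, of "\<lambda>x. f x * g x"] borel_measurable_integrable[OF int'[OF f g]]
      by simp
    finally show ?thesis unfolding distr .
  qed
qed

theorem theorem3p2:
  fixes n d :: nat and B :: "nat list" and \<mu> :: "(nat \<Rightarrow> real) measure"
  assumes "n \<ge> 1"
    and "2 * d \<le> n"
    and "B \<in> top_sets n d"
    and "exchangeable n \<mu>"
    and "\<And>f g. f \<in> harmonic_multilinear n \<Longrightarrow> g \<in> harmonic_multilinear n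
           \<Longrightarrow> integrable \<mu> (\<lambda>x. f x * g x)"
  shows "(norm_mu \<mu> (chi_top n B))\<^sup>2 = c_coeff B * (norm_mu \<mu> (chi_deg d))\<^sup>2"
proof -
  have B: "sorted_wrt (<) B" "distinct B" "set B \<subseteq> {1..n}" "length B = d"
    using assms(3) by (auto simp: top_sets_def seqs_def)
  have "lowers B \<noteq> {}"
    using assms(3) B(4) unfolding lowers_eq_seqs[OF B(2,3)] by (auto simp: top_sets_def)
  then have top: "chi_top n B \<in> chi_span n d"
    using chi_top_chi_span[OF B(2,3)] B(4) unfolding chi_top_lowers[OF B(2,3)] by simp
  obtain w where w: "\<And>L. invariant_form n d L \<Longrightarrow>
      L (\<lambda>x. chi_top n B x * chi_top n B x) = w * L (\<lambda>x. chi_deg d x * chi_deg d x)"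
    using invariant_form_proportional[OF assms(2) top top] by blast
  \<comment> \<open>The cube with weight 1 determines \<open>w\<close>, which then serves for the
    measure.\<close>
  have "c_coeff B * (\<Sum>x\<in>cube n. chi_deg d x * chi_deg d x)
      = (\<Sum>x\<in>cube n. chi_top n B x * chi_top n B x)"
    using sum_cube_chi_top[OF B(1,3) \<open>lowers B \<noteq> {}\<close>] B(4)
    by (simp add: chi_top_lowers[OF B(2,3)])
  also have "\<dots> = w * (\<Sum>x\<in>cube n. chi_deg d x * chi_deg d x)"
    using w[OF invariant_form_cube[of n n "\<lambda>_. 1"]] by simp
  finally have "w = c_coeff B" using sum_cube_chi_deg_pos[OF assms(2)] by simp
  moreover have "(norm_mu \<mu> f)\<^sup>2 = (LINT x|\<mu>. f x * f x)" for f
    by (simp add: norm_mu_def inner_mu_def)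
  moreover have "invariant_form n d (\<lambda>f. LINT x|\<mu>. f x)"
    using assms(4) by (rule invariant_form_exchangeable) (rule assms(5))
  ultimately show ?thesis using w by simp
qed

end
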